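(* Let $\xi=(\xi_t)_{t\ge0}$ be a real-valued Lévy process with Lévy exponent $\Phi$, i.e. $\mathbb{E}(e^{\lambda\xi_t})=e^{-t\Phi(\lambda)}$, such that $-\infty\le\mathbb{E}(\xi_1)<0$ and such that Cramér's condition holds: there exists $\chi>0$ with $\Phi(\chi)=0$. Let $A_\infty:=\int_0^\infty e^{\xi_s}\,ds$. Then $$\mathbb{E}\left(A_\infty^{\alpha}\right)<\infty\qquad\text{for all } 0\le\alpha<\chi .$$
   Context: For real $\lambda$, the Lévy exponent $\Phi(\lambda)\in[-\infty,\infty)$ is defined by $\mathbb{E}(e^{\lambda\xi_t})=e^{-t\Phi(\lambda)}$, with $\Phi(\lambda)=-\infty$ when $\mathbb{E}(e^{\lambda\xi_1})=+\infty$. Lévy processes start at $0$. *)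

theory Defs
  imports "HOL-Probability.Probability"
begin

(* Only the values at times t >= 0 matter. Stochastic continuity is not listed, since it
   follows from stationarity of the increments together with right-continuity at 0. *)
definition levy_process :: "'a measure \<Rightarrow> (real \<Rightarrow> 'a \<Rightarrow> real) \<Rightarrow> bool" where
  "levy_process M X \<longleftrightarrow>
     prob_space M \<and>
     (\<forall>t\<ge>0. X t \<in> borel_measurable M) \<and>
     (AE \<omega> in M. X 0 \<omega> = 0) \<and>
     (\<forall>(n::nat) (t::nat \<Rightarrow> real). 0 \<le> t 0 \<longrightarrow> (\<forall>i<n. t i \<le> t (Suc i)) \<longrightarrow>
        prob_space.indep_vars M (\<lambda>_. borel) (\<lambda>i \<omega>. X (t (Suc i)) \<omega> - X (t i) \<omega>) {..<n}) \<and>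
     (\<forall>s\<ge>0. \<forall>t\<ge>0. distr M borel (\<lambda>\<omega>. X (s + t) \<omega> - X s \<omega>) = distr M borel (X t)) \<and>
     (AE \<omega> in M. \<forall>t\<ge>0. continuous (at_right t) (\<lambda>s. X s \<omega>) \<and>
        (0 < t \<longrightarrow> (\<exists>l. ((\<lambda>s. X s \<omega>) \<longlongrightarrow> l) (at_left t))))"

fun exp_ereal :: "ereal \<Rightarrow> ennreal" where
  "exp_ereal (ereal r) = ennreal (exp r)"
| "exp_ereal PInfty = \<infinity>"
| "exp_ereal MInfty = 0"

(* The equation at t = 1 determines \<Phi>: an infinite exponential moment corresponds to the value
   -\<infinity>. At t = 0 both sides are 1, because 0 * \<infinity> = 0 in ereal. *)
definition levy_exponent :: "'a measure \<Rightarrow> (real \<Rightarrow> 'a \<Rightarrow> real) \<Rightarrow> (real \<Rightarrow> ereal) \<Rightarrow> bool" where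
  "levy_exponent M X \<Phi> \<longleftrightarrow>
     (\<forall>l. \<Phi> l < \<infinity> \<and>
       (\<forall>t\<ge>0. (\<integral>\<^sup>+\<omega>. ennreal (exp (l * X t \<omega>)) \<partial>M) = exp_ereal (- (ereal t * \<Phi> l))))"

(* The mean with values in [-\<infinity>, \<infinity>], as E(Y^+) - E(Y^-); ennreal truncates negative reals to 0.
   In the undefined case \<infinity> - \<infinity> the value is \<infinity>, so an upper bound below \<infinity> on the mean
   entails that E(Y^+) is finite. *)
definition ereal_expectation :: "'a measure \<Rightarrow> ('a \<Rightarrow> real) \<Rightarrow> ereal" where
  "ereal_expectation M Y =
     enn2ereal (\<integral>\<^sup>+\<omega>. ennreal (Y \<omega>) \<partial>M) - enn2ereal (\<integral>\<^sup>+\<omega>. ennreal (- Y \<omega>) \<partial>M)"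

definition exponential_functional :: "(real \<Rightarrow> 'a \<Rightarrow> real) \<Rightarrow> 'a \<Rightarrow> ennreal" where
  "exponential_functional X \<omega> = (\<integral>\<^sup>+s\<in>{0..}. ennreal (exp (X s \<omega>)) \<partial>lborel)"

(* Intended for exponents a >= 0, with x^0 = 1 for every x (powr has 0 powr 0 = 0). *)
definition ennreal_powr :: "ennreal \<Rightarrow> real \<Rightarrow> ennreal" where
  "ennreal_powr x a =
     (if a = 0 then 1 else if x = \<infinity> then \<infinity> else ennreal (enn2real x powr a))"

end

(*
  By strict convexity the exponent is positive on (0, chi), so for alpha < b < chi and
  e = \<Phi> b > 0 the process V_t = exp (b * \<xi>_t + e * t) is a martingale, and its supremum W satisfies
  P (W > a) <= 1 / a.  The discount e turns this into a bound of the whole integral: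
  A <= W^(1/b) * b / e, whence A^alpha is at most a constant times W^(alpha/b), which is
  integrable because alpha / b < 1.
*)
theory Submission
  imports Defs "HOL-Real_Asymp.Real_Asymp"
begin

section \<open>Strict convexity of exponential moments\<close>

lemma exp_convex_strict:
  fixes p y :: real
  assumes "0 < p" "p < 1" "y \<noteq> 0"
  shows "exp (p * y) < 1 - p + p * exp y"
proof -
  have nz: "(1 - p) * y \<noteq> 0" "- (p * y) \<noteq> 0" using assms by auto
  (* Tangent line of exp at p * y. *)
  have strict: "1 + z < exp z" if "z \<noteq> 0" for z :: real
    using exp_minus_greater[of "-z"] that by (smt (verit) exp_ge_add_one_self)
  \<comment> \<open>The points 0 and \<open>y\<close> lie at offsets \<open>- (p * y)\<close> and
    \<open>(1 - p) * y\<close> from the point of tangency. With weights \<open>1 - p\<close> and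
    \<open>p\<close> these offsets average to 0, so the linear terms cancel.\<close>
  have "exp (p * y) * 1 = exp (p * y) * ((1 - p) * (1 - p * y) + p * (1 + (1 - p) * y))"
    by (simp add: algebra_simps)
  also have "\<dots> < exp (p * y) * ((1 - p) * exp (- (p * y)) + p * exp ((1 - p) * y))"
    using strict[OF nz(1)] strict[OF nz(2)] assms
    by (intro mult_strict_left_mono add_strict_mono) auto
  also have "\<dots> = (1 - p) * exp (p * y + - (p * y)) + p * exp (p * y + (1 - p) * y)"
    by (simp only: exp_add) (simp add: algebra_simps)
  also have "\<dots> = 1 - p + p * exp y"
    by (simp add: algebra_simps)
  finally show ?thesis by simp
qed

text \<open>Convexity puts \<open>exp (b * X)\<close> below the average of 1 and
  \<open>exp (c * X)\<close> with weight \<open>p = b / c\<close> on the latter, and both of these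
  have mean 1. The gap \<open>g\<close> is nonnegative and vanishes only where \<open>X\<close>
  does, so its integral is strictly positive.\<close>

lemma (in prob_space) nn_integral_exp_less_one:
  fixes X :: "'a \<Rightarrow> real"
  assumes X [measurable]: "X \<in> borel_measurable M"
    and chi: "(\<integral>\<^sup>+\<omega>. ennreal (exp (c * X \<omega>)) \<partial>M) = 1"
    and b: "0 < b" "b < c"
    and nz: "\<not> (AE \<omega> in M. X \<omega> = 0)"
  shows "(\<integral>\<^sup>+\<omega>. ennreal (exp (b * X \<omega>)) \<partial>M) < 1"
proof -
  define p where "p = b / c"
  have p: "0 < p" "p < 1" using b by (auto simp: p_def)
  have bp: "b = p * c" using b by (simp add: p_def)
  define g where "g \<omega> = 1 - p + p * exp (c * X \<omega>) - exp (b * X \<omega>)" for \<omega>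
  have g0: "0 \<le> g \<omega>" and g_eq: "g \<omega> = 0 \<Longrightarrow> X \<omega> = 0" for \<omega>
  proof -
    show "0 \<le> g \<omega>" "g \<omega> = 0 \<Longrightarrow> X \<omega> = 0"
      using exp_convex_strict[OF p, of "c * X \<omega>"] b
      by (cases "X \<omega> = 0"; auto simp: g_def bp mult.assoc)+
  qed
  have [measurable]: "g \<in> borel_measurable M" unfolding g_def by measurable
  let ?E = "\<integral>\<^sup>+\<omega>. ennreal (exp (b * X \<omega>)) \<partial>M"
  have "?E + (\<integral>\<^sup>+\<omega>. ennreal (g \<omega>) \<partial>M) = (\<integral>\<^sup>+\<omega>. ennreal (exp (b * X \<omega>)) + ennreal (g \<omega>) \<partial>M)"
    by (intro nn_integral_add[symmetric]) auto
  also have "\<dots> = (\<integral>\<^sup>+\<omega>. ennreal (1 - p) + ennreal p * ennreal (exp (c * X \<omega>)) \<partial>M)"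
    using p g0 by (intro nn_integral_cong)
      (auto simp: g_def ennreal_plus[symmetric] ennreal_mult[symmetric] simp del: ennreal_plus)
  also have "\<dots> = ennreal (1 - p) + ennreal p"
    by (subst nn_integral_add) (auto simp: nn_integral_cmult chi emeasure_space_1)
  also have "\<dots> = 1" using p by (simp flip: ennreal_plus)
  finally have sum: "?E + (\<integral>\<^sup>+\<omega>. ennreal (g \<omega>) \<partial>M) = 1" .
  have "(\<integral>\<^sup>+\<omega>. ennreal (g \<omega>) \<partial>M) \<noteq> 0"
  proof
    assume "(\<integral>\<^sup>+\<omega>. ennreal (g \<omega>) \<partial>M) = 0"
    then have "AE \<omega> in M. ennreal (g \<omega>) = 0"
      by (subst (asm) nn_integral_0_iff_AE) auto
    then have "AE \<omega> in M. X \<omega> = 0"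
      by eventually_elim (metis g0 g_eq ennreal_eq_0_iff order_antisym)
    with nz show False by simp
  qed
  moreover have "?E \<le> 1" using sum by (metis le_iff_add)
  moreover have "?E \<noteq> 1"
  proof
    assume "?E = 1"
    with sum have "1 + (\<integral>\<^sup>+\<omega>. ennreal (g \<omega>) \<partial>M) = 1 + 0" by simp
    with \<open>(\<integral>\<^sup>+\<omega>. ennreal (g \<omega>) \<partial>M) \<noteq> 0\<close> show False
      by (subst (asm) ennreal_add_left_cancel) simp
  qed
  ultimately show ?thesis by (simp add: order_le_less)
qed

section \<open>Maximal inequality for products of independent factors\<close>

lemma (in prob_space) indep_var_nn_integral_mult:
  fixes f g :: "'a \<Rightarrow> ennreal"
  assumes "indep_var borel f borel g"
  shows "(\<integral>\<^sup>+\<omega>. f \<omega> * g \<omega> \<partial>M) = (\<integral>\<^sup>+\<omega>. f \<omega> \<partial>M) * (\<integral>\<^sup>+\<omega>. g \<omega> \<partial>M)"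
proof -
  have "indep_vars (\<lambda>_. borel) (case_bool f g) UNIV"
    using assms unfolding indep_var_def
    by (subst indep_vars_cong[OF refl refl, where N'="case_bool borel borel"]) (auto split: bool.split)
  from indep_vars_nn_integral[OF _ this] show ?thesis
    by (simp add: UNIV_bool mult.commute)
qed

text \<open>Freezing the partial products at the first passage above \<open>a\<close> reduces the maximal inequality
  to Markov's inequality for the last term.\<close>

primrec stopped_prod :: "ennreal \<Rightarrow> (nat \<Rightarrow> ennreal) \<Rightarrow> nat \<Rightarrow> ennreal" where
  "stopped_prod a y 0 = 1"
| "stopped_prod a y (Suc k) =
     (if a < stopped_prod a y k then stopped_prod a y k else stopped_prod a y k * y k)"

lemma stopped_prod_gt:
  assumes "k \<le> n" "a < (\<Prod>i<k. y i)"
  shows "a < stopped_prod a y n"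
proof -
  have "(\<exists>k\<le>n. a < stopped_prod a y k) \<longrightarrow> a < stopped_prod a y n"
    by (induction n) (auto simp: le_Suc_eq)
  moreover have "(\<forall>k<m. \<not> a < stopped_prod a y k) \<longrightarrow> stopped_prod a y m = (\<Prod>i<m. y i)" for m
    by (induction m) auto
  ultimately show ?thesis using assms
    by (metis order_less_le_trans less_imp_le)
qed

lemma stopped_prod_cong:
  "(\<And>i. i < n \<Longrightarrow> y i = z i) \<Longrightarrow> stopped_prod a y n = stopped_prod a z n"
  by (induction n) auto

lemma measurable_stopped_prod:
  assumes "\<And>i. i < n \<Longrightarrow> Y i \<in> borel_measurable M"
  shows "(\<lambda>\<omega>. stopped_prod a (\<lambda>i. Y i \<omega>) n) \<in> borel_measurable M"
  using assms
proof (induction n)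
  case (Suc n)
  then have [measurable]: "(\<lambda>\<omega>. stopped_prod a (\<lambda>i. Y i \<omega>) n) \<in> borel_measurable M"
    "Y n \<in> borel_measurable M" by auto
  show ?case by simp
qed simp

text \<open>This is the supermartingale property: a step multiplies the part not yet frozen by an
  independent factor of mean at most 1. The length \<open>m\<close> is separate from
  \<open>n\<close> so that the induction leaves the independent family fixed.\<close>

lemma (in prob_space) nn_integral_stopped_prod_le_1:
  assumes ind: "indep_vars (\<lambda>_. borel) Y {..<n}"
    and le: "\<And>i. i < n \<Longrightarrow> (\<integral>\<^sup>+\<omega>. Y i \<omega> \<partial>M) \<le> 1"
    and "m \<le> n"
  shows "(\<integral>\<^sup>+\<omega>. stopped_prod a (\<lambda>i. Y i \<omega>) m \<partial>M) \<le> 1"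
  using \<open>m \<le> n\<close>
proof (induction m)
  case 0
  then show ?case by (simp add: emeasure_space_1)
next
  case (Suc m)
  define N where "N \<omega> = stopped_prod a (\<lambda>i. Y i \<omega>) m" for \<omega>
  \<comment> \<open>Writing \<open>N\<close> as a function of the factors with index below
    \<open>m\<close> makes it independent of \<open>Y m\<close>.\<close>
  have N_eq: "N \<omega> = stopped_prod a (restrict (\<lambda>i. Y i \<omega>) {..<m}) m" for \<omega>
    unfolding N_def by (rule stopped_prod_cong) auto
  have ind2: "indep_var (PiM {..<m} (\<lambda>_. borel)) (\<lambda>\<omega>. restrict (\<lambda>i. Y i \<omega>) {..<m})
      (PiM {m} (\<lambda>_. borel)) (\<lambda>\<omega>. restrict (\<lambda>i. Y i \<omega>) {m})"
    using Suc.prems by (intro indep_var_restrict[OF ind]) auto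
  \<comment> \<open>\<open>h\<close> cuts out the part that has not yet passed \<open>a\<close>;
    only this part meets the new factor.\<close>
  define h where "h x = (if a < x then 0 else x)" for x :: ennreal
  have [measurable]: "h \<in> borel_measurable borel" unfolding h_def by measurable
  have meas_st [measurable]:
    "(\<lambda>y. stopped_prod a y m) \<in> borel_measurable (PiM {..<m} (\<lambda>_. borel))"
    by (rule measurable_stopped_prod) simp
  have "indep_var borel ((\<lambda>y. h (stopped_prod a y m)) \<circ> (\<lambda>\<omega>. restrict (\<lambda>i. Y i \<omega>) {..<m}))
      borel ((\<lambda>y. y m) \<circ> (\<lambda>\<omega>. restrict (\<lambda>i. Y i \<omega>) {m}))"
    by (rule indep_var_compose[OF ind2]) measurable
  then have indep: "indep_var borel (\<lambda>\<omega>. h (N \<omega>)) borel (Y m)"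
    by (simp add: o_def N_eq)
  have [measurable]: "N \<in> borel_measurable M"
    using measurable_compose[OF indep_var_rv1[OF ind2] meas_st] by (simp add: N_eq[abs_def])
  have [measurable]: "Y m \<in> borel_measurable M"
    by (rule indep_var_rv2[OF indep])
  have "(\<integral>\<^sup>+\<omega>. stopped_prod a (\<lambda>i. Y i \<omega>) (Suc m) \<partial>M)
      = (\<integral>\<^sup>+\<omega>. (if a < N \<omega> then N \<omega> else 0) + h (N \<omega>) * Y m \<omega> \<partial>M)"
    by (intro nn_integral_cong) (auto simp: N_def h_def)
  also have "\<dots> = (\<integral>\<^sup>+\<omega>. (if a < N \<omega> then N \<omega> else 0) \<partial>M) + (\<integral>\<^sup>+\<omega>. h (N \<omega>) * Y m \<omega> \<partial>M)"
    by (intro nn_integral_add) auto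
  also have "(\<integral>\<^sup>+\<omega>. h (N \<omega>) * Y m \<omega> \<partial>M) \<le> (\<integral>\<^sup>+\<omega>. h (N \<omega>) \<partial>M) * 1"
    unfolding indep_var_nn_integral_mult[OF indep]
    using le[of m] Suc.prems by (intro mult_left_mono) auto
  also have "(\<integral>\<^sup>+\<omega>. (if a < N \<omega> then N \<omega> else 0) \<partial>M) + (\<integral>\<^sup>+\<omega>. h (N \<omega>) \<partial>M) * 1
      = (\<integral>\<^sup>+\<omega>. (if a < N \<omega> then N \<omega> else 0) + h (N \<omega>) \<partial>M)"
    by (subst nn_integral_add) auto
  also have "\<dots> = (\<integral>\<^sup>+\<omega>. N \<omega> \<partial>M)"
    by (intro nn_integral_cong) (auto simp: h_def)
  also have "\<dots> \<le> 1" using Suc unfolding N_def by simp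
  finally show ?case by (simp add: add_left_mono)
qed

text \<open>If some partial product exceeds \<open>a\<close>, so does the last frozen product, whose
  mean is at most 1; Markov's inequality then gives the bound, uniformly in
  \<open>n\<close>.\<close>

lemma (in prob_space) maximal_inequality_prod:
  fixes Y :: "nat \<Rightarrow> 'a \<Rightarrow> ennreal"
  assumes ind: "indep_vars (\<lambda>_. borel) Y {..<n}"
    and le: "\<And>i. i < n \<Longrightarrow> (\<integral>\<^sup>+\<omega>. Y i \<omega> \<partial>M) \<le> 1"
    and a: "0 < a"
  shows "emeasure M {\<omega>\<in>space M. \<exists>k\<le>n. ennreal a < (\<Prod>i<k. Y i \<omega>)} \<le> ennreal (1 / a)"
proof -
  let ?N = "\<lambda>\<omega>. stopped_prod (ennreal a) (\<lambda>i. Y i \<omega>) n"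
  have [measurable]: "Y i \<in> borel_measurable M" if "i < n" for i
    using ind that by (auto simp: indep_vars_def)
  have [measurable]: "?N \<in> borel_measurable M"
    by (rule measurable_stopped_prod) measurable
  have "emeasure M {\<omega>\<in>space M. \<exists>k\<le>n. ennreal a < (\<Prod>i<k. Y i \<omega>)}
      \<le> emeasure M {\<omega>\<in>space M. 1 \<le> ennreal (1 / a) * ?N \<omega>}"
  proof (intro emeasure_mono subsetI)
    fix \<omega> assume "\<omega> \<in> {\<omega>\<in>space M. \<exists>k\<le>n. ennreal a < (\<Prod>i<k. Y i \<omega>)}"
    then have sp: "\<omega> \<in> space M" and "ennreal a < ?N \<omega>" by (auto intro: stopped_prod_gt)
    then have "ennreal (1 / a) * ennreal a \<le> ennreal (1 / a) * ?N \<omega>"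
      by (intro mult_left_mono) auto
    then show "\<omega> \<in> {\<omega>\<in>space M. 1 \<le> ennreal (1 / a) * ?N \<omega>}"
      using a sp by (simp flip: ennreal_mult)
  qed measurable
  also have "\<dots> = emeasure M ({\<omega>\<in>space M. 1 \<le> ennreal (1 / a) * ?N \<omega>} \<inter> space M)"
    by (rule arg_cong[where f="emeasure M"]) auto
  also have "\<dots> \<le> ennreal (1 / a) * (\<integral>\<^sup>+\<omega>. ?N \<omega> * indicator (space M) \<omega> \<partial>M)"
    using nn_integral_Markov_inequality[of ?N "space M" M "ennreal (1 / a)"]
    by (simp add: Int_def conj_commute)
  also have "(\<integral>\<^sup>+\<omega>. ?N \<omega> * indicator (space M) \<omega> \<partial>M) = (\<integral>\<^sup>+\<omega>. ?N \<omega> \<partial>M)"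
    by (intro nn_integral_cong) simp
  also have "ennreal (1 / a) * \<dots> \<le> ennreal (1 / a) * 1"
    by (intro mult_left_mono nn_integral_stopped_prod_le_1[OF ind le]) auto
  finally show ?thesis by simp
qed

section \<open>Pathwise bounds\<close>

text \<open>Every \<open>s\<close> is a limit from the right of points \<open>k / 2 ^ m\<close>. The
  level \<open>m\<close> grid ends at \<open>4 ^ m / 2 ^ m = 2 ^ m\<close>, so it eventually reaches
  beyond \<open>s\<close>.\<close>

lemma right_continuous_le_of_dyadic:
  fixes f :: "real \<Rightarrow> real"
  assumes s: "0 \<le> s" and cont: "continuous (at_right s) f"
    and le: "\<And>m k. k \<le> 4 ^ m \<Longrightarrow> f (real k / 2 ^ m) \<le> a"
  shows "f s \<le> a"
proof -
  \<comment> \<open>The successor keeps the grid point strictly to the right of \<open>s\<close>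
    even when \<open>s\<close> is dyadic, as \<open>at_right s\<close> demands.\<close>
  define k where "k m = Suc (nat \<lfloor>s * 2 ^ m\<rfloor>)" for m :: nat
  have k_gt: "s * 2 ^ m < real (k m)" and k_le: "real (k m) \<le> s * 2 ^ m + 1" for m
    using s by (auto simp: k_def) linarith+
  have d_gt: "s < real (k m) / 2 ^ m" and d_le: "real (k m) / 2 ^ m \<le> s + (1 / 2) ^ m" for m
    using k_gt[of m] k_le[of m] by (auto simp: field_simps)
  have "(\<lambda>m. (1 / 2 :: real) ^ m) \<longlonglongrightarrow> 0"
    by (rule LIMSEQ_realpow_zero) auto
  from tendsto_add[OF tendsto_const[of s] this]
  have upper: "(\<lambda>m. s + (1 / 2) ^ m) \<longlonglongrightarrow> s" by simp
  have "(\<lambda>m. real (k m) / 2 ^ m) \<longlonglongrightarrow> s"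
    by (rule tendsto_sandwich[OF always_eventually always_eventually tendsto_const upper])
      (use d_gt d_le in \<open>auto intro: less_imp_le\<close>)
  then have "filterlim (\<lambda>m. real (k m) / 2 ^ m) (at_right s) sequentially"
    using d_gt by (auto simp: filterlim_at less_imp_neq[symmetric])
  moreover have "(f \<longlongrightarrow> f s) (at_right s)"
    using cont by (simp add: continuous_within)
  ultimately have lim: "(\<lambda>m. f (real (k m) / 2 ^ m)) \<longlonglongrightarrow> f s"
    by (rule filterlim_compose[rotated])
  have "filterlim (\<lambda>m. 2 ^ m :: real) at_top sequentially"
    by real_asymp
  \<comment> \<open>The extra 1 absorbs the rounding up in \<open>k m\<close>, so that
    \<open>k m \<le> 4 ^ m\<close>.\<close>
  then have "\<forall>\<^sub>F m in sequentially. s + 1 \<le> 2 ^ m"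
    by (simp add: filterlim_at_top)
  then have "\<forall>\<^sub>F m in sequentially. f (real (k m) / 2 ^ m) \<le> a"
  proof eventually_elim
    case (elim m)
    have "real (k m) \<le> s * 2 ^ m + 1 * 2 ^ m"
      using k_le[of m] by (smt (verit) one_le_power)
    also have "\<dots> \<le> 2 ^ m * 2 ^ m"
      using mult_right_mono[OF elim, of "2 ^ m"] by (simp add: distrib_right)
    also have "\<dots> = real (4 ^ m)"
      by (simp flip: power_mult_distrib)
    finally have "k m \<le> 4 ^ m" by (simp only: of_nat_le_iff)
    then show ?case by (rule le)
  qed
  with lim show ?thesis by (intro tendsto_upperbound) auto
qed

text \<open>Solving the bound for \<open>X s\<close> gives a linear upper bound of slope
  \<open>- (c / b)\<close>, so the integrand decays exponentially; the factor \<open>b / c\<close>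
  is the integral of \<open>exp (- (c / b * s))\<close> over the half-line.\<close>

lemma exponential_functional_le:
  assumes b: "0 < b" and c: "0 < c" and a: "0 < a"
    and bound: "\<And>s. 0 \<le> s \<Longrightarrow> exp (b * X s \<omega> + c * s) \<le> a"
  shows "exponential_functional X \<omega> \<le> ennreal (a powr (1 / b) * (b / c))"
proof -
  have "exponential_functional X \<omega>
      \<le> (\<integral>\<^sup>+s. ennreal (a powr (1 / b) * exp (- (c / b * s))) * indicator {0..} s \<partial>lborel)"
    unfolding exponential_functional_def
  proof (intro nn_integral_mono)
    fix s :: real
    have "exp (X s \<omega>) \<le> a powr (1 / b) * exp (- (c / b * s))" if "0 \<le> s"
    proof -
      have "b * X s \<omega> + c * s \<le> ln a"
        using bound[OF that] a by (subst ln_ge_iff) auto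
      then have "X s \<omega> \<le> ln a / b - c / b * s"
        using b by (simp add: field_simps)
      then have "exp (X s \<omega>) \<le> exp (ln a / b + - (c / b * s))" by simp
      also have "\<dots> = a powr (1 / b) * exp (- (c / b * s))"
        using a by (simp add: powr_def exp_add exp_minus exp_diff field_simps)
      finally show ?thesis .
    qed
    then show "ennreal (exp (X s \<omega>)) * indicator {0..} s
        \<le> ennreal (a powr (1 / b) * exp (- (c / b * s))) * indicator {0..} s"
      by (auto simp: ennreal_leI split: split_indicator)
  qed
  also have "\<dots> = ennreal (0 - (- (a powr (1 / b) * (b / c)) * exp (- (c / b * 0))))"
  proof (rule nn_integral_FTC_atLeast)
    show "((\<lambda>s. - (a powr (1 / b) * (b / c)) * exp (- (c / b * s))) \<longlongrightarrow> 0) at_top"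
      using b c by real_asymp
  qed (use b c in \<open>auto intro!: derivative_eq_intros\<close>)
  finally show ?thesis by simp
qed

lemma ennreal_powr_le:
  assumes "x \<le> ennreal y" "0 \<le> y" "0 < p"
  shows "ennreal_powr x p \<le> ennreal (y powr p)"
proof -
  have "x \<noteq> top" using assms(1) by (auto simp: top_unique)
  moreover have "enn2real x \<le> y"
    using enn2real_mono[OF assms(1)] assms(2) by simp
  ultimately show ?thesis
    using assms(3) by (auto simp: ennreal_powr_def intro!: ennreal_leI powr_mono2)
qed

section \<open>Integrability from geometric tails\<close>

text \<open>Split according to the first \<open>k\<close> with \<open>\<omega> \<notin> B k\<close>.
  If it is \<open>j + 1\<close>, then \<open>\<omega> \<in> B j\<close>, an event of probability at
  most \<open>1 / 2 ^ j\<close>, while \<open>f\<close> is at most \<open>K * r ^ Suc j\<close>. The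
  resulting series is geometric with ratio \<open>r / 2 < 1\<close>.\<close>

lemma (in prob_space) nn_integral_finite_dyadic_tails:
  fixes f :: "'a \<Rightarrow> ennreal"
  assumes B [measurable]: "\<And>k. B k \<in> sets M"
    and tail: "\<And>k. emeasure M (B k) \<le> ennreal (1 / 2 ^ k)"
    and r: "0 \<le> r" "r < 2" and K: "0 \<le> K"
    and f: "AE \<omega> in M. \<forall>k. \<omega> \<notin> B k \<longrightarrow> f \<omega> \<le> ennreal (K * r ^ k)"
  shows "(\<integral>\<^sup>+\<omega>. f \<omega> \<partial>M) < \<infinity>"
proof -
  \<comment> \<open>Borel-Cantelli ensures that a first such index exists almost surely.\<close>
  have "AE \<omega> in M. \<forall>\<^sub>F k in sequentially. \<omega> \<in> space M - B k"
  proof (rule borel_cantelli_AE1)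
    have "norm (measure M (B k)) \<le> (1 / 2) ^ k" for k
      using tail[of k] by (simp add: emeasure_eq_measure power_divide)
    moreover have "summable (\<lambda>k. (1 / 2) ^ k :: real)"
      by (rule summable_geometric) simp
    ultimately show "summable (\<lambda>k. measure M (B k))"
      by (rule summable_comparison_test'[rotated])
  qed (simp_all add: less_top[symmetric])
  then have ex: "AE \<omega> in M. \<exists>k. \<omega> \<notin> B k"
    by eventually_elim (auto simp: eventually_sequentially)
  \<comment> \<open>The constant \<open>K\<close> covers first index 0, and the term with index
    \<open>k\<close> covers first index \<open>Suc k\<close>, hence the shifted power.\<close>
  define F where "F \<omega> = ennreal K + (\<Sum>k. ennreal (K * r ^ Suc k) * indicator (B k) \<omega>)" for \<omega>
  from f ex have "AE \<omega> in M. f \<omega> \<le> F \<omega>"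
  proof eventually_elim
    case (elim \<omega>)
    define n where "n = (LEAST k. \<omega> \<notin> B k)"
    have n: "\<omega> \<notin> B n" unfolding n_def by (rule LeastI_ex) (use elim in auto)
    then have fn: "f \<omega> \<le> ennreal (K * r ^ n)" using elim by blast
    show ?case
    proof (cases n)
      case 0
      then show ?thesis using fn by (simp add: F_def add_increasing2)
    next
      case (Suc j)
      then have "\<omega> \<in> B j" using not_less_Least[of j "\<lambda>k. \<omega> \<notin> B k"] by (auto simp: n_def)
      with fn Suc have "f \<omega> \<le> (\<Sum>k\<in>{j}. ennreal (K * r ^ Suc k) * indicator (B k) \<omega>)" by simp
      also have "\<dots> \<le> (\<Sum>k. ennreal (K * r ^ Suc k) * indicator (B k) \<omega>)"
        by (rule sum_le_suminf) auto
      also have "\<dots> \<le> F \<omega>" by (simp add: F_def)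
      finally show ?thesis .
    qed
  qed
  then have "(\<integral>\<^sup>+\<omega>. f \<omega> \<partial>M) \<le> (\<integral>\<^sup>+\<omega>. F \<omega> \<partial>M)" by (rule nn_integral_mono_AE)
  also have "\<dots> = ennreal K + (\<Sum>k. ennreal (K * r ^ Suc k) * emeasure M (B k))"
    unfolding F_def
    by (subst nn_integral_add)
      (auto simp: nn_integral_suminf nn_integral_cmult_indicator emeasure_space_1)
  also have "\<dots> \<le> ennreal K + (\<Sum>k. ennreal (K * r * (r / 2) ^ k))"
  proof (intro add_left_mono suminf_le)
    fix k
    have "ennreal (K * r ^ Suc k) * emeasure M (B k) \<le> ennreal (K * r ^ Suc k) * ennreal (1 / 2 ^ k)"
      by (intro mult_left_mono tail) auto
    also have "\<dots> = ennreal (K * r * (r / 2) ^ k)"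
      using K r by (subst ennreal_mult[symmetric]) (auto simp: power_divide)
    finally show "ennreal (K * r ^ Suc k) * emeasure M (B k) \<le> ennreal (K * r * (r / 2) ^ k)" .
  qed auto
  also have "\<dots> < \<infinity>"
  proof -
    have "summable (\<lambda>k. K * r * (r / 2) ^ k)"
      using r by (intro summable_mult summable_geometric) auto
    then have "(\<Sum>k. ennreal (K * r * (r / 2) ^ k)) \<noteq> top"
      using K r by (intro ennreal_suminf_neq_top) auto
    then show ?thesis by (simp add: less_top)
  qed
  finally show ?thesis .
qed

section \<open>Maximal inequality for the exponential martingale\<close>

text \<open>The bound \<open>4 ^ m\<close> makes the grid of mesh \<open>1 / 2 ^ m\<close> cover the
  interval from 0 to \<open>2 ^ m\<close>: mesh and horizon are refined together, so one increasing
  sequence of events exhausts all dyadic times.\<close>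

definition dyadic_exceed :: "'a measure \<Rightarrow> (real \<Rightarrow> 'a \<Rightarrow> real) \<Rightarrow> real \<Rightarrow> nat \<Rightarrow> 'a set" where
  "dyadic_exceed M V a m = {\<omega>\<in>space M. \<exists>k\<le>4 ^ m. a < V (real k / 2 ^ m) \<omega>}"

lemma incseq_dyadic_exceed: "incseq (dyadic_exceed M V a)"
proof (rule incseq_SucI, rule subsetI)
  fix m \<omega> assume "\<omega> \<in> dyadic_exceed M V a m"
  then obtain k where k: "\<omega> \<in> space M" "k \<le> 4 ^ m" "a < V (real k / 2 ^ m) \<omega>"
    by (auto simp: dyadic_exceed_def)
  have "real (2 * k) / 2 ^ Suc m = real k / 2 ^ m" by simp
  with k show "\<omega> \<in> dyadic_exceed M V a (Suc m)"
    unfolding dyadic_exceed_def by (auto intro!: exI[of _ "2 * k"])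
qed

text \<open>Along each grid \<open>V\<close> is almost surely a product of independent factors of
  mean 1, so the discrete inequality holds with the same bound \<open>1 / a\<close> at every level.
  Continuity of the measure along increasing events carries it to the union.\<close>

lemma levy_maximal_inequality:
  fixes X :: "real \<Rightarrow> 'a \<Rightarrow> real"
  assumes levy: "levy_process M X"
    and expo: "\<And>t. 0 \<le> t \<Longrightarrow> (\<integral>\<^sup>+\<omega>. ennreal (exp (b * X t \<omega>)) \<partial>M) = ennreal (exp (- (c * t)))"
    and a: "0 < a"
  defines "V \<equiv> \<lambda>t \<omega>. exp (b * X t \<omega> + c * t)"
  shows "(\<Union>m. dyadic_exceed M V a m) \<in> sets M"
    and "emeasure M (\<Union>m. dyadic_exceed M V a m) \<le> ennreal (1 / a)"
proof -
  interpret prob_space M using levy by (simp add: levy_process_def)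
  have X [measurable]: "X t \<in> borel_measurable M" if "0 \<le> t" for t
    using levy that by (simp add: levy_process_def)
  have V [measurable]: "V (real k / 2 ^ m) \<in> borel_measurable M" for k m :: nat
    unfolding V_def by measurable
  have sets: "dyadic_exceed M V a m \<in> sets M" for m
    unfolding dyadic_exceed_def by measurable
  then show "(\<Union>m. dyadic_exceed M V a m) \<in> sets M" by auto
  have X0: "AE \<omega> in M. X 0 \<omega> = 0" using levy by (simp add: levy_process_def)
  have "emeasure M (dyadic_exceed M V a m) \<le> ennreal (1 / a)" for m
  proof -
    define h where "h = 1 / (2 ^ m :: real)"
    have h: "0 < h" by (simp add: h_def)
    define t where "t i = real i * h" for i :: nat
    \<comment> \<open>\<open>g\<close> maps an increment of \<open>X\<close> over one mesh step to
      the ratio of consecutive values of \<open>V\<close>.\<close>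
    define g where "g x = ennreal (exp (b * x + c * h))" for x
    have [measurable]: "g \<in> borel_measurable borel" unfolding g_def by measurable
    define Y where "Y i \<omega> = g (X (t (Suc i)) \<omega> - X (t i) \<omega>)" for i \<omega>
    have t: "0 \<le> t i" "t i \<le> t (Suc i)" "t (Suc i) = t i + h" for i
      using h by (auto simp: t_def algebra_simps)
    have "indep_vars (\<lambda>_. borel) (\<lambda>i \<omega>. X (t (Suc i)) \<omega> - X (t i) \<omega>) {..<4 ^ m}"
      using levy t(1)[of 0] t(2) by (simp add: levy_process_def)
    then have ind: "indep_vars (\<lambda>_. borel) Y {..<4 ^ m}"
      unfolding Y_def by (rule indep_vars_compose2) measurable
    \<comment> \<open>By stationarity the increment is distributed as \<open>X h\<close>, and the
      factor \<open>exp (c * h)\<close> cancels its exponential moment.\<close>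
    have "(\<integral>\<^sup>+\<omega>. Y i \<omega> \<partial>M) = 1" for i
    proof -
      have "(\<integral>\<^sup>+\<omega>. Y i \<omega> \<partial>M) = (\<integral>\<^sup>+x. g x \<partial>distr M borel (\<lambda>\<omega>. X (t i + h) \<omega> - X (t i) \<omega>))"
        unfolding Y_def t(3) using t(1)[of i] h
        by (subst nn_integral_distr) (auto intro!: borel_measurable_diff X)
      also have "distr M borel (\<lambda>\<omega>. X (t i + h) \<omega> - X (t i) \<omega>) = distr M borel (X h)"
        using levy t(1)[of i] h by (simp add: levy_process_def)
      also have "(\<integral>\<^sup>+x. g x \<partial>distr M borel (X h)) = (\<integral>\<^sup>+\<omega>. g (X h \<omega>) \<partial>M)"
        using h by (intro nn_integral_distr) auto
      also have "\<dots> = (\<integral>\<^sup>+\<omega>. ennreal (exp (c * h)) * ennreal (exp (b * X h \<omega>)) \<partial>M)"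
        by (simp add: g_def exp_add ennreal_mult' mult.commute)
      also have "\<dots> = ennreal (exp (c * h)) * ennreal (exp (- (c * h)))"
        using h by (subst nn_integral_cmult) (auto simp: expo)
      also have "\<dots> = 1" by (simp flip: ennreal_mult exp_add)
      finally show ?thesis .
    qed
    then have "emeasure M {\<omega>\<in>space M. \<exists>k\<le>4 ^ m. ennreal a < (\<Prod>i<k. Y i \<omega>)} \<le> ennreal (1 / a)"
      by (intro maximal_inequality_prod[OF ind _ a]) simp
    \<comment> \<open>The product telescopes to \<open>V\<close> only where \<open>X 0 = 0\<close>,
      so the two events are compared almost everywhere.\<close>
    moreover have "emeasure M (dyadic_exceed M V a m)
        \<le> emeasure M {\<omega>\<in>space M. \<exists>k\<le>4 ^ m. ennreal a < (\<Prod>i<k. Y i \<omega>)}"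
    proof (rule emeasure_mono_AE)
      show "AE \<omega> in M. \<omega> \<in> dyadic_exceed M V a m \<longrightarrow>
          \<omega> \<in> {\<omega>\<in>space M. \<exists>k\<le>4 ^ m. ennreal a < (\<Prod>i<k. Y i \<omega>)}"
        using X0
      proof eventually_elim
        case (elim \<omega>)
        have "(\<Prod>i<k. Y i \<omega>) = ennreal (V (real k / 2 ^ m) \<omega>)" for k
        proof -
          have "(\<Prod>i<k. Y i \<omega>) = ennreal (exp (b * X (t k) \<omega> + c * t k))"
          proof (induction k)
            case 0
            then show ?case by (simp add: t_def elim)
          next
            case (Suc k)
            then show ?case
              by (simp add: Y_def g_def t(3) algebra_simps flip: ennreal_mult exp_add)
          qed
          then show ?thesis by (simp add: V_def t_def h_def)
        qed
        then show ?case using a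
          by (auto simp: dyadic_exceed_def ennreal_less_iff)
      qed
      have [measurable]: "Y i \<in> borel_measurable M" for i
        unfolding Y_def using t(1)[of i] t(1)[of "Suc i"] by measurable
      show "{\<omega>\<in>space M. \<exists>k\<le>4 ^ m. ennreal a < (\<Prod>i<k. Y i \<omega>)} \<in> sets M" by measurable
    qed
    ultimately show ?thesis by (rule order_trans[rotated])
  qed
  then show "emeasure M (\<Union>m. dyadic_exceed M V a m) \<le> ennreal (1 / a)"
    using sets by (subst SUP_emeasure_incseq[symmetric]) (auto simp: incseq_dyadic_exceed intro: SUP_least)
qed

section \<open>Positivity of the exponent below the Cramer root\<close>

text \<open>The negative mean rules out \<open>X 1 = 0\<close> almost surely, so strict convexity
  between the exponents 0 and \<open>c\<close>, where the moment is 1, pushes the moment at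
  \<open>b\<close> below 1.\<close>

lemma levy_exponent_pos:
  assumes levy: "levy_process M X" and expo: "levy_exponent M X \<Phi>"
    and mean: "ereal_expectation M (X 1) < 0"
    and b: "0 < b" "b < c" and c: "\<Phi> c = 0"
  obtains e where "0 < e" "\<Phi> b = ereal e"
proof -
  interpret prob_space M using levy by (simp add: levy_process_def)
  have X1 [measurable]: "X 1 \<in> borel_measurable M" using levy by (simp add: levy_process_def)
  have ex: "(\<integral>\<^sup>+\<omega>. ennreal (exp (l * X 1 \<omega>)) \<partial>M) = exp_ereal (- \<Phi> l)" "\<Phi> l < \<infinity>" for l
    using expo by (auto simp: levy_exponent_def one_ereal_def[symmetric])
  have "\<not> (AE \<omega> in M. X 1 \<omega> = 0)"
  proof
    assume "AE \<omega> in M. X 1 \<omega> = 0"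
    then have "AE \<omega> in M. ennreal (X 1 \<omega>) = 0" "AE \<omega> in M. ennreal (- X 1 \<omega>) = 0"
      by (auto elim!: eventually_mono)
    then have "(\<integral>\<^sup>+\<omega>. ennreal (X 1 \<omega>) \<partial>M) = 0" "(\<integral>\<^sup>+\<omega>. ennreal (- X 1 \<omega>) \<partial>M) = 0"
      by (simp_all add: nn_integral_0_iff_AE del: ennreal_eq_0_iff)
    with mean show False by (simp add: ereal_expectation_def)
  qed
  moreover have "(\<integral>\<^sup>+\<omega>. ennreal (exp (c * X 1 \<omega>)) \<partial>M) = 1"
    using ex(1)[of c] c by (simp add: zero_ereal_def)
  ultimately have "exp_ereal (- \<Phi> b) < 1"
    using nn_integral_exp_less_one[OF X1 _ b] ex(1)[of b] by simp
  \<comment> \<open>The value \<infinity> is excluded by \<open>levy_exponent\<close>, and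
    -\<infinity> would make the moment infinite; a real value must be positive for the moment to be
    below 1.\<close>
  with ex(2)[of b] that show ?thesis
    by (cases "\<Phi> b") (auto simp: exp_ereal.simps(2)[folded infinity_ereal_def])
qed

section \<open>Moments of the exponential functional\<close>

theorem proposition3p1:
  fixes M :: "'a measure"
    and \<xi> :: "real \<Rightarrow> 'a \<Rightarrow> real"
    and \<Phi> :: "real \<Rightarrow> ereal"
    and chi :: real
  assumes "levy_process M \<xi>"
    and "levy_exponent M \<xi> \<Phi>"
    and "- \<infinity> \<le> ereal_expectation M (\<xi> 1)" and "ereal_expectation M (\<xi> 1) < 0"
    and "chi > 0" and "\<Phi> chi = 0"
  shows "\<forall>\<alpha>::real. 0 \<le> \<alpha> \<and> \<alpha> < chi \<longrightarrow>
           (\<integral>\<^sup>+\<omega>. ennreal_powr (exponential_functional \<xi> \<omega>) \<alpha> \<partial>M) < \<infinity>"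
proof (intro allI impI, elim conjE)
  fix \<alpha> :: real assume \<alpha>: "0 \<le> \<alpha>" "\<alpha> < chi"
  interpret prob_space M using assms(1) by (simp add: levy_process_def)
  show "(\<integral>\<^sup>+\<omega>. ennreal_powr (exponential_functional \<xi> \<omega>) \<alpha> \<partial>M) < \<infinity>"
  proof (cases "\<alpha> = 0")
    case True
    then show ?thesis by (simp add: ennreal_powr_def emeasure_space_1)
  next
    case False
    with \<alpha> have pos: "0 < \<alpha>" by simp
    \<comment> \<open>\<open>b < chi\<close> yields a positive discount rate \<open>e\<close>, and
      \<open>\<alpha> < b\<close> yields the ratio \<open>2 powr (\<alpha> / b) < 2\<close> that the
      tail lemma requires.\<close>
    obtain b where b: "\<alpha> < b" "b < chi" using dense[OF \<alpha>(2)] by blast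
    with pos have b0: "0 < b" by simp
    obtain e where e: "0 < e" "\<Phi> b = ereal e"
      using levy_exponent_pos[OF assms(1,2,4) b0 b(2) assms(6)] .
    have expo: "(\<integral>\<^sup>+\<omega>. ennreal (exp (b * \<xi> t \<omega>)) \<partial>M) = ennreal (exp (- (e * t)))" if "0 \<le> t" for t
      using assms(2) that e by (simp add: levy_exponent_def mult.commute)
    define V where "V t \<omega> = exp (b * \<xi> t \<omega> + e * t)" for t \<omega>
    \<comment> \<open>\<open>B k\<close> is the event that \<open>V\<close> exceeds
      \<open>2 ^ k\<close> at some dyadic time. Off it the functional is at most
      \<open>(2 ^ k) powr (1 / b) * (b / e)\<close>; the power \<alpha> of this bound supplies
      \<open>K = (b / e) powr \<alpha>\<close> and \<open>r = 2 powr (\<alpha> / b)\<close>.\<close>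
    define B where "B k = (\<Union>m. dyadic_exceed M V (2 ^ k) m)" for k :: nat
    show ?thesis
    proof (rule nn_integral_finite_dyadic_tails)
      show "B k \<in> sets M" "emeasure M (B k) \<le> ennreal (1 / 2 ^ k)" for k
        using levy_maximal_inequality[OF assms(1) expo, of "2 ^ k"]
        by (auto simp: B_def V_def[abs_def])
      show "0 \<le> 2 powr (\<alpha> / b)" "0 \<le> (b / e) powr \<alpha>" by simp_all
      have "2 powr (\<alpha> / b) < (2::real) powr 1"
        using b b0 by (intro powr_less_mono) auto
      then show "2 powr (\<alpha> / b) < (2::real)" by simp
      have "AE \<omega> in M. \<forall>t\<ge>0. continuous (at_right t) (\<lambda>s. \<xi> s \<omega>) \<and>
          (0 < t \<longrightarrow> (\<exists>l. ((\<lambda>s. \<xi> s \<omega>) \<longlongrightarrow> l) (at_left t)))"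
        using assms(1) unfolding levy_process_def by (elim conjE)
      then show "AE \<omega> in M. \<forall>k. \<omega> \<notin> B k \<longrightarrow> ennreal_powr (exponential_functional \<xi> \<omega>) \<alpha>
          \<le> ennreal ((b / e) powr \<alpha> * (2 powr (\<alpha> / b)) ^ k)"
        using AE_space
      proof eventually_elim
        case (elim \<omega>)
        show ?case
        proof (intro allI impI)
          fix k assume k: "\<omega> \<notin> B k"
          \<comment> \<open>Right-continuity of the path extends the bound from dyadic times to all
            times.\<close>
          have "exp (b * \<xi> s \<omega> + e * s) \<le> 2 ^ k" if "0 \<le> s" for s
          proof (rule right_continuous_le_of_dyadic[OF that])
            show "continuous (at_right s) (\<lambda>s. exp (b * \<xi> s \<omega> + e * s))"
              using elim that by (intro continuous_intros) auto
          qed (use k elim in \<open>auto simp: B_def dyadic_exceed_def V_def not_less\<close>)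
          then have "exponential_functional \<xi> \<omega> \<le> ennreal ((2 ^ k) powr (1 / b) * (b / e))"
            using b0 e by (intro exponential_functional_le) auto
          then have "ennreal_powr (exponential_functional \<xi> \<omega>) \<alpha>
              \<le> ennreal (((2 ^ k) powr (1 / b) * (b / e)) powr \<alpha>)"
            using b0 e pos by (intro ennreal_powr_le) auto
          also have "((2 ^ k) powr (1 / b) * (b / e)) powr \<alpha> = (b / e) powr \<alpha> * (2 powr (\<alpha> / b)) ^ k"
            using b0 e by (subst powr_mult) (auto simp: powr_powr mult_ac simp flip: powr_realpow)
          finally show "ennreal_powr (exponential_functional \<xi> \<omega>) \<alpha>
              \<le> ennreal ((b / e) powr \<alpha> * (2 powr (\<alpha> / b)) ^ k)" .
        qed
      qed
    qed
  qed
qed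

end
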